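(* Let $X$ be a topological space and let $\mathfrak{B}$ be a collection of open subsets of $X$ satisfying the properties $(B_I)$ and $(B_{II})$. Then the topology on $X$ deduced from the uniform structure $\mathfrak{U}$ is coarser than (or equal to) the original topology of $X$. These two topologies coincide if and only if $\mathfrak{B}$ satisfies the following property: $(B_{III})$ For every $x\in X$ and every neighbourhood $Y$ of $x$ for the original topology of $X$, there is a cover $C\in\mathfrak{C}$ such that the union of the elements of $C$ containing $x$ is contained in $Y$.
   Context: $\mathfrak{C}$ denotes the collection of all finite covers of $X$ by elements of $\mathfrak{B}$. The properties are: $(B_I)$ Every non-empty finite intersection of elements of $\mathfrak{B}$ belongs to $\mathfrak{B}$ (here "finite intersection" includes the intersection of the empty family, which is $X$). $(B_{II})$ For every cover $C\in\mathfrak{C}$ there is a cover $C'\in\mathfrak{C}$ such that for every point $x\in X$ the union of all the elements of $C'$ containing $x$ is contained in one of the elements of $C$. For $C\in\mathfrak{C}$, $V(C)=\bigcup_{Y\in C}Y\times Y$, and $\mathfrak{U}$ is the uniform structure on $X$ consisting of all $V\subset X\times X$ containing $V(C)$ for some $C\in\mathfrak{C}$. The topology deduced from $\mathfrak{U}$ is the one for which the neighbourhoods of $x\in X$ are the sets $V(x)=\{x'\in X:(x,x')\in V\}$, $V\in\mathfrak{U}$. *)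

theory Defs
  imports "HOL-Analysis.Analysis"
begin

definition neighbourhood_in :: "'a topology \<Rightarrow> 'a \<Rightarrow> 'a set \<Rightarrow> bool" where
  "neighbourhood_in T x N \<longleftrightarrow> N \<subseteq> topspace T \<and> (\<exists>W. openin T W \<and> x \<in> W \<and> W \<subseteq> N)"

definition coarser_or_equal :: "'a topology \<Rightarrow> 'a topology \<Rightarrow> bool" where
  "coarser_or_equal T T' \<longleftrightarrow>
     topspace T = topspace T' \<and> (\<forall>W. openin T W \<longrightarrow> openin T' W)"


subsection \<open>Uniform structures on a set (in the sense of Bourbaki)\<close>

definition uniform_structure :: "'a set \<Rightarrow> ('a \<times> 'a) set set \<Rightarrow> bool" where
  "uniform_structure S \<U> \<longleftrightarrow>
     (\<forall>V\<in>\<U>. V \<subseteq> S \<times> S) \<and>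
     S \<times> S \<in> \<U> \<and>
     (\<forall>V\<in>\<U>. \<forall>W. V \<subseteq> W \<and> W \<subseteq> S \<times> S \<longrightarrow> W \<in> \<U>) \<and>
     (\<forall>V\<in>\<U>. \<forall>W\<in>\<U>. V \<inter> W \<in> \<U>) \<and>
     (\<forall>V\<in>\<U>. Id_on S \<subseteq> V) \<and>
     (\<forall>V\<in>\<U>. converse V \<in> \<U>) \<and>
     (\<forall>V\<in>\<U>. \<exists>W\<in>\<U>. W O W \<subseteq> V)"

text \<open>
  The topology deduced from \<open>\<U>\<close> is specified through its neighbourhoods: those of \<open>x\<close> are
  exactly the sets \<open>V(x) = {x'. (x, x') \<in> V}\<close>, written \<open>V `` {x}\<close> below. The lemma
  \<open>ex1_uniform_topology\<close> shows that the description is proper for every uniform structure.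
\<close>

definition is_uniform_topology :: "'a set \<Rightarrow> ('a \<times> 'a) set set \<Rightarrow> 'a topology \<Rightarrow> bool" where
  "is_uniform_topology S \<U> T \<longleftrightarrow>
     topspace T = S \<and>
     (\<forall>x\<in>S. \<forall>N. neighbourhood_in T x N \<longleftrightarrow> (\<exists>V\<in>\<U>. N = V `` {x}))"

definition uniform_topology :: "'a set \<Rightarrow> ('a \<times> 'a) set set \<Rightarrow> 'a topology" where
  "uniform_topology S \<U> = (THE T. is_uniform_topology S \<U> T)"

lemma openin_is_uniform_topology:
  assumes "is_uniform_topology S \<U> T"
  shows "openin T W \<longleftrightarrow> W \<subseteq> S \<and> (\<forall>x\<in>W. \<exists>V\<in>\<U>. W = V `` {x})"
proof -
  have S: "topspace T = S"
    and N: "\<And>x N. x \<in> S \<Longrightarrow> neighbourhood_in T x N \<longleftrightarrow> (\<exists>V\<in>\<U>. N = V `` {x})"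
    using assms by (auto simp: is_uniform_topology_def)
  have "openin T W \<longleftrightarrow> W \<subseteq> S \<and> (\<forall>x\<in>W. neighbourhood_in T x W)"
    using openin_subopen[of T W] openin_subset[of T W] S
    unfolding neighbourhood_in_def by blast
  also have "\<dots> \<longleftrightarrow> W \<subseteq> S \<and> (\<forall>x\<in>W. \<exists>V\<in>\<U>. W = V `` {x})"
    by (intro conj_cong refl ball_cong N) (rule subsetD)
  finally show ?thesis .
qed

lemma is_uniform_topology_unique:
  assumes "is_uniform_topology S \<U> T" "is_uniform_topology S \<U> T'"
  shows "T = T'"
  unfolding topology_eq openin_is_uniform_topology[OF assms(1)]
    openin_is_uniform_topology[OF assms(2)] by (intro allI refl)

lemma is_uniform_topology_exists:
  assumes U: "uniform_structure S \<U>"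
  shows "\<exists>T. is_uniform_topology S \<U> T"
proof -
  have sub: "V \<subseteq> S \<times> S" if "V \<in> \<U>" for V
    using U[unfolded uniform_structure_def, THEN conjunct1] that by (rule bspec)
  note U2 = U[unfolded uniform_structure_def, THEN conjunct2]
  have full: "S \<times> S \<in> \<U>"
    using U2[THEN conjunct1] .
  have up: "W \<in> \<U>" if "V \<in> \<U>" "V \<subseteq> W" "W \<subseteq> S \<times> S" for V W
    using U2[THEN conjunct2, THEN conjunct1, rule_format, OF that(1)] that(2,3) by simp
  note U4 = U2[THEN conjunct2, THEN conjunct2]
  have int: "V \<inter> W \<in> \<U>" if "V \<in> \<U>" "W \<in> \<U>" for V W
    using U4[THEN conjunct1, rule_format, OF that] .
  note U5 = U4[THEN conjunct2]
  have diag: "(x, x) \<in> V" if "V \<in> \<U>" "x \<in> S" for V x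
    using U5[THEN conjunct1, rule_format, OF that(1)] that(2) by (rule subsetD[OF _ Id_onI])
  have half: "\<exists>W\<in>\<U>. W O W \<subseteq> V" if "V \<in> \<U>" for V
    using U5[THEN conjunct2, THEN conjunct2, rule_format, OF that] .
  define P where "P = (\<lambda>W. W \<subseteq> S \<and> (\<forall>x\<in>W. \<exists>V\<in>\<U>. V `` {x} \<subseteq> W))"
  have Psub: "W \<subseteq> S" if "P W" for W using that by (simp add: P_def)
  have Pnb: "\<exists>V\<in>\<U>. V `` {x} \<subseteq> W" if "P W" "x \<in> W" for W x
    using that unfolding P_def by (elim conjE) (rule bspec)
  have "istopology P"
    unfolding istopology_def
  proof (intro conjI allI impI)
    fix A B assume A: "P A" and B: "P B"
    show "P (A \<inter> B)"
      unfolding P_def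
    proof (intro conjI ballI)
      show "A \<inter> B \<subseteq> S" using Psub[OF A] by blast
      fix x assume x: "x \<in> A \<inter> B"
      obtain V where V: "V \<in> \<U>" "V `` {x} \<subseteq> A" using Pnb[OF A] x by blast
      obtain W where W: "W \<in> \<U>" "W `` {x} \<subseteq> B" using Pnb[OF B] x by blast
      have "(V \<inter> W) `` {x} \<subseteq> A \<inter> B" using V W by blast
      then show "\<exists>V\<in>\<U>. V `` {x} \<subseteq> A \<inter> B" using int[OF V(1) W(1)] by blast
    qed
  next
    fix K assume K: "\<forall>A\<in>K. P A"
    show "P (\<Union>K)"
      unfolding P_def
    proof (intro conjI ballI)
      show "\<Union>K \<subseteq> S" using K Psub by blast
      fix x assume "x \<in> \<Union>K"
      then obtain A where A: "A \<in> K" "x \<in> A" by blast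
      then obtain V where "V \<in> \<U>" "V `` {x} \<subseteq> A" using Pnb[of A x] K by blast
      then show "\<exists>V\<in>\<U>. V `` {x} \<subseteq> \<Union>K" using A by blast
    qed
  qed
  then have op: "openin (topology P) W \<longleftrightarrow> P W" for W
    by (simp add: topology_inverse')
  have "P S" using full by (auto simp: P_def)
  then have top: "topspace (topology P) = S"
    unfolding topspace_def op using Psub by blast
  have "neighbourhood_in (topology P) x N \<longleftrightarrow> (\<exists>V\<in>\<U>. N = V `` {x})" if x: "x \<in> S" for x N
  proof
    assume "neighbourhood_in (topology P) x N"
    then obtain W where W: "N \<subseteq> S" "P W" "x \<in> W" "W \<subseteq> N"
      unfolding neighbourhood_in_def top op by blast
    obtain V where "V \<in> \<U>" "V `` {x} \<subseteq> W" using Pnb[OF W(2,3)] by blast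
    then have V: "V \<in> \<U>" "V `` {x} \<subseteq> N" using W(4) by auto
    have "V \<union> {x} \<times> N \<in> \<U>"
      using sub[OF V(1)] W(1) x by (intro up[OF V(1)]) auto
    moreover have "N = (V \<union> {x} \<times> N) `` {x}" using V(2) by auto
    ultimately show "\<exists>V\<in>\<U>. N = V `` {x}" by blast
  next
    assume "\<exists>V\<in>\<U>. N = V `` {x}"
    then obtain V where V: "V \<in> \<U>" and N: "N = V `` {x}" by blast
    define W where "W = {y \<in> S. \<exists>V'\<in>\<U>. V' `` {y} \<subseteq> N}"
    have "P W"
      unfolding P_def
    proof (intro conjI ballI)
      show "W \<subseteq> S" by (auto simp: W_def)
      fix y assume "y \<in> W"
      then obtain V' where V': "V' \<in> \<U>" "V' `` {y} \<subseteq> N" by (auto simp: W_def)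
      obtain H where H: "H \<in> \<U>" "H O H \<subseteq> V'" using half[OF V'(1)] by blast
      have "H `` {y} \<subseteq> W"
      proof
        fix z assume z: "z \<in> H `` {y}"
        then have "z \<in> S" using sub[OF H(1)] by auto
        moreover have "H `` {z} \<subseteq> N" using z H(2) V'(2) by blast
        ultimately show "z \<in> W" using H(1) by (auto simp: W_def)
      qed
      then show "\<exists>V\<in>\<U>. V `` {y} \<subseteq> W" using H(1) by blast
    qed
    moreover have "x \<in> W" using x V N by (auto simp: W_def)
    moreover have "W \<subseteq> N"
    proof
      fix y assume "y \<in> W"
      then obtain V' where V': "y \<in> S" "V' \<in> \<U>" "V' `` {y} \<subseteq> N" by (auto simp: W_def)
      then show "y \<in> N" using diag[OF V'(2,1)] by blast
    qed
    moreover have "N \<subseteq> S" using sub[OF V] N by auto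
    ultimately show "neighbourhood_in (topology P) x N"
      unfolding neighbourhood_in_def top op by blast
  qed
  with top have "is_uniform_topology S \<U> (topology P)"
    unfolding is_uniform_topology_def by (intro conjI ballI allI)
  then show ?thesis ..
qed

lemma ex1_uniform_topology:
  assumes "uniform_structure S \<U>"
  shows "\<exists>!T. is_uniform_topology S \<U> T"
  using is_uniform_topology_exists[OF assms] is_uniform_topology_unique by blast

lemma is_uniform_topology_uniform_topology:
  assumes "uniform_structure S \<U>"
  shows "is_uniform_topology S \<U> (uniform_topology S \<U>)"
  unfolding uniform_topology_def by (rule theI'[OF ex1_uniform_topology[OF assms]])


subsection \<open>The uniform structure defined by finite covers\<close>

definition finite_covers :: "'a set \<Rightarrow> 'a set set \<Rightarrow> 'a set set set" where
  "finite_covers S \<B> = {C. finite C \<and> C \<subseteq> \<B> \<and> \<Union>C = S}"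

definition cover_star :: "'a set set \<Rightarrow> 'a \<Rightarrow> 'a set" where
  "cover_star C x = \<Union>{Y \<in> C. x \<in> Y}"

text \<open>
  Intersecting with \<open>S\<close> makes the intersection of the empty family equal to \<open>S\<close>, whereas
  \<open>\<Inter>{}\<close> is the universe of the type. ``Non-empty'' refers to the resulting set.
\<close>

definition B_I :: "'a set \<Rightarrow> 'a set set \<Rightarrow> bool" where
  "B_I S \<B> \<longleftrightarrow> (\<forall>F. finite F \<and> F \<subseteq> \<B> \<and> S \<inter> \<Inter>F \<noteq> {} \<longrightarrow> S \<inter> \<Inter>F \<in> \<B>)"

definition B_II :: "'a set \<Rightarrow> 'a set set \<Rightarrow> bool" where
  "B_II S \<B> \<longleftrightarrow>
     (\<forall>C\<in>finite_covers S \<B>. \<exists>C'\<in>finite_covers S \<B>. \<forall>x\<in>S. \<exists>Y\<in>C. cover_star C' x \<subseteq> Y)"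

definition B_III :: "'a topology \<Rightarrow> 'a set set \<Rightarrow> bool" where
  "B_III T \<B> \<longleftrightarrow>
     (\<forall>x\<in>topspace T. \<forall>Y. neighbourhood_in T x Y \<longrightarrow>
        (\<exists>C\<in>finite_covers (topspace T) \<B>. cover_star C x \<subseteq> Y))"

definition cover_entourage :: "'a set set \<Rightarrow> ('a \<times> 'a) set" where
  "cover_entourage C = (\<Union>Y\<in>C. Y \<times> Y)"

definition cover_uniformity :: "'a set \<Rightarrow> 'a set set \<Rightarrow> ('a \<times> 'a) set set" where
  "cover_uniformity S \<B> =
     {V. V \<subseteq> S \<times> S \<and> (\<exists>C\<in>finite_covers S \<B>. cover_entourage C \<subseteq> V)}"

lemma uniform_structure_cover_uniformity:
  assumes I: "B_I S \<B>" and II: "B_II S \<B>"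
  shows "uniform_structure S (cover_uniformity S \<B>)"
  unfolding uniform_structure_def
proof (intro conjI ballI allI impI)
  fix V assume "V \<in> cover_uniformity S \<B>"
  then obtain C where V: "V \<subseteq> S \<times> S" and C: "C \<in> finite_covers S \<B>" "cover_entourage C \<subseteq> V"
    by (auto simp: cover_uniformity_def)
  show "V \<subseteq> S \<times> S" by (fact V)
  show "Id_on S \<subseteq> V"
  proof
    fix p assume "p \<in> Id_on S"
    then obtain x where x: "x \<in> S" "p = (x, x)" by blast
    then obtain Y where "Y \<in> C" "x \<in> Y" using C(1) by (auto simp: finite_covers_def)
    then show "p \<in> V" using C(2) x(2) by (auto simp: cover_entourage_def)
  qed
  have "cover_entourage C \<subseteq> converse V"
    using C(2) by (auto simp: cover_entourage_def)
  moreover have "converse V \<subseteq> S \<times> S" using V by auto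
  ultimately show "converse V \<in> cover_uniformity S \<B>"
    using C(1) unfolding cover_uniformity_def by blast
  show "W \<in> cover_uniformity S \<B>" if "V \<subseteq> W \<and> W \<subseteq> S \<times> S" for W
    using C that unfolding cover_uniformity_def by blast
  obtain C' where C': "C' \<in> finite_covers S \<B>" "\<forall>x\<in>S. \<exists>Y\<in>C. cover_star C' x \<subseteq> Y"
    using II C(1) unfolding B_II_def by blast
  have "cover_entourage C' O cover_entourage C' \<subseteq> V"
  proof
    fix p assume "p \<in> cover_entourage C' O cover_entourage C'"
    then obtain x y z where p: "p = (x, z)" and xy: "(x, y) \<in> cover_entourage C'"
      and yz: "(y, z) \<in> cover_entourage C'" by blast
    have "y \<in> S" using xy C'(1) by (auto simp: cover_entourage_def finite_covers_def)
    then obtain Y where Y: "Y \<in> C" "cover_star C' y \<subseteq> Y" using C'(2) by blast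
    have "x \<in> cover_star C' y" "z \<in> cover_star C' y"
      using xy yz by (auto simp: cover_entourage_def cover_star_def)
    then have "p \<in> cover_entourage C" using Y p by (auto simp: cover_entourage_def)
    then show "p \<in> V" using C(2) by blast
  qed
  moreover have "cover_entourage C' \<in> cover_uniformity S \<B>"
    using C'(1) by (auto simp: cover_uniformity_def cover_entourage_def finite_covers_def)
  ultimately show "\<exists>W\<in>cover_uniformity S \<B>. W O W \<subseteq> V" by blast
  fix W assume "W \<in> cover_uniformity S \<B>"
  then obtain D where D: "D \<in> finite_covers S \<B>" "cover_entourage D \<subseteq> W"
    by (auto simp: cover_uniformity_def)
  define E where "E = (\<lambda>(Y, Z). Y \<inter> Z) ` (C \<times> D) - {{}}"
  have "E \<subseteq> \<B>"
  proof
    fix A assume "A \<in> E"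
    then obtain Y Z where YZ: "Y \<in> C" "Z \<in> D" "A = Y \<inter> Z" "A \<noteq> {}" by (auto simp: E_def)
    then have *: "S \<inter> \<Inter>{Y, Z} = A" using C(1) by (auto simp: finite_covers_def)
    moreover have "{Y, Z} \<subseteq> \<B>" using YZ C(1) D(1) by (auto simp: finite_covers_def)
    ultimately have "S \<inter> \<Inter>{Y, Z} \<in> \<B>"
      using I[unfolded B_I_def, rule_format, of "{Y, Z}"] YZ(4) by simp
    then show "A \<in> \<B>" using * by simp
  qed
  moreover have "finite E" using C(1) D(1) by (auto simp: E_def finite_covers_def)
  moreover have "\<Union>E = S"
  proof
    show "\<Union>E \<subseteq> S" using C(1) by (auto simp: E_def finite_covers_def)
    show "S \<subseteq> \<Union>E"
    proof
      fix x assume "x \<in> S"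
      then have "x \<in> \<Union>C" "x \<in> \<Union>D" using C(1) D(1) by (simp_all add: finite_covers_def)
      then obtain Y Z where "Y \<in> C" "Z \<in> D" "x \<in> Y \<inter> Z" by blast
      moreover from this have "Y \<inter> Z \<in> E" by (auto simp: E_def)
      ultimately show "x \<in> \<Union>E" by blast
    qed
  qed
  ultimately have "E \<in> finite_covers S \<B>" by (simp add: finite_covers_def)
  moreover have "cover_entourage E \<subseteq> cover_entourage C \<inter> cover_entourage D"
    by (auto simp: cover_entourage_def E_def)
  ultimately show "V \<inter> W \<in> cover_uniformity S \<B>"
    using V C(2) D(2) unfolding cover_uniformity_def by blast
next
  have "finite_covers S \<B> \<noteq> {}"
  proof (cases "S = {}")
    case True
    then have "{} \<in> finite_covers S \<B>" by (simp add: finite_covers_def)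
    then show ?thesis by blast
  next
    case False
    then have "S \<in> \<B>" using I[unfolded B_I_def, rule_format, of "{}"] by simp
    then have "{S} \<in> finite_covers S \<B>" by (simp add: finite_covers_def)
    then show ?thesis by blast
  qed
  then obtain C where C: "C \<in> finite_covers S \<B>" by blast
  then have "cover_entourage C \<subseteq> S \<times> S"
    by (auto simp: finite_covers_def cover_entourage_def)
  then show "S \<times> S \<in> cover_uniformity S \<B>"
    using C unfolding cover_uniformity_def by blast
qed

end

theory Submission
  imports Defs
begin

text \<open>
  Everything rests on one computation: cutting the entourage of a cover \<open>C\<close> at \<open>x\<close> gives the
  star of \<open>x\<close>, i.e. the union of the elements of \<open>C\<close> containing \<open>x\<close>. Hence the stars of \<open>x\<close> with
  respect to the finite covers form a base of neighbourhoods of \<open>x\<close> for the uniform topology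
  (\<open>neighbourhood_in_uniform_topology_iff\<close>). Being unions of elements of \<open>\<B>\<close>, these stars are open
  in \<open>X\<close>, so every uniform neighbourhood is a neighbourhood for \<open>X\<close>. Property \<open>B_III\<close> says
  exactly the converse, that every neighbourhood for \<open>X\<close> contains a star and so is a uniform
  neighbourhood. As a topology is determined by its neighbourhoods
  (\<open>openin_iff_neighbourhood_in\<close>), this gives both assertions.
\<close>

lemma openin_iff_neighbourhood_in:
  "openin T W \<longleftrightarrow> W \<subseteq> topspace T \<and> (\<forall>x\<in>W. neighbourhood_in T x W)"
  using openin_subopen[of T W] openin_subset[of T W]
  unfolding neighbourhood_in_def by blast

lemma cover_entourage_Image: "cover_entourage C `` {x} = cover_star C x"
  by (auto simp: cover_entourage_def cover_star_def)

lemma mem_cover_star: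
  assumes "C \<in> finite_covers S \<B>" "x \<in> S"
  shows "x \<in> cover_star C x"
  using assms by (auto simp: finite_covers_def cover_star_def)

lemma openin_cover_star:
  assumes "\<And>Y. Y \<in> \<B> \<Longrightarrow> openin X Y" "C \<in> finite_covers S \<B>"
  shows "openin X (cover_star C x)"
  unfolding cover_star_def using assms by (intro openin_Union) (auto simp: finite_covers_def)

text \<open>
  A set containing a star may fail to be a section of the entourage of that cover. Enlarging the
  entourage along \<open>{x} \<times> N\<close> alone makes the section at \<open>x\<close> equal to \<open>N\<close> without leaving the
  uniformity.
\<close>

lemma cover_uniformity_section_iff:
  assumes x: "x \<in> S"
  shows "(\<exists>V\<in>cover_uniformity S \<B>. N = V `` {x}) \<longleftrightarrow>
    N \<subseteq> S \<and> (\<exists>C\<in>finite_covers S \<B>. cover_star C x \<subseteq> N)"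
proof
  assume "\<exists>V\<in>cover_uniformity S \<B>. N = V `` {x}"
  then obtain V C where V: "V \<subseteq> S \<times> S" "N = V `` {x}"
    and C: "C \<in> finite_covers S \<B>" "cover_entourage C \<subseteq> V"
    by (auto simp: cover_uniformity_def)
  have "cover_star C x \<subseteq> N"
    unfolding V(2) cover_entourage_Image[symmetric] using C(2) by blast
  then show "N \<subseteq> S \<and> (\<exists>C\<in>finite_covers S \<B>. cover_star C x \<subseteq> N)"
    using V C(1) by blast
next
  assume "N \<subseteq> S \<and> (\<exists>C\<in>finite_covers S \<B>. cover_star C x \<subseteq> N)"
  then obtain C where N: "N \<subseteq> S" and C: "C \<in> finite_covers S \<B>" "cover_star C x \<subseteq> N"
    by blast
  define V where "V = cover_entourage C \<union> {x} \<times> N"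
  have "cover_entourage C \<subseteq> S \<times> S"
    using C(1) by (auto simp: cover_entourage_def finite_covers_def)
  then have "V \<in> cover_uniformity S \<B>"
    using x N C(1) unfolding cover_uniformity_def V_def by blast
  moreover have "V `` {x} = cover_star C x \<union> N"
    unfolding cover_entourage_Image[symmetric] V_def by blast
  then have "N = V `` {x}" using C(2) by blast
  ultimately show "\<exists>V\<in>cover_uniformity S \<B>. N = V `` {x}" by blast
qed

lemma neighbourhood_in_uniform_topology_iff:
  assumes "B_I S \<B>" "B_II S \<B>" "x \<in> S"
  shows "neighbourhood_in (uniform_topology S (cover_uniformity S \<B>)) x N \<longleftrightarrow>
    N \<subseteq> S \<and> (\<exists>C\<in>finite_covers S \<B>. cover_star C x \<subseteq> N)"
  using is_uniform_topology_uniform_topology[OF uniform_structure_cover_uniformity[OF assms(1,2)]]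
    assms(3)
  by (simp add: is_uniform_topology_def cover_uniformity_section_iff)

lemma topspace_uniform_topology:
  assumes "B_I S \<B>" "B_II S \<B>"
  shows "topspace (uniform_topology S (cover_uniformity S \<B>)) = S"
  using is_uniform_topology_uniform_topology[OF uniform_structure_cover_uniformity[OF assms]]
  by (simp add: is_uniform_topology_def)

theorem proposition3p3:
  fixes X :: "'a topology" and \<B> :: "'a set set"
  assumes "\<And>Y. Y \<in> \<B> \<Longrightarrow> openin X Y"
    and "B_I (topspace X) \<B>"
    and "B_II (topspace X) \<B>"
  shows "coarser_or_equal (uniform_topology (topspace X) (cover_uniformity (topspace X) \<B>)) X \<and>
    (uniform_topology (topspace X) (cover_uniformity (topspace X) \<B>) = X \<longleftrightarrow> B_III X \<B>)"
proof -
  define T where "T = uniform_topology (topspace X) (cover_uniformity (topspace X) \<B>)"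
  have top: "topspace T = topspace X"
    unfolding T_def by (rule topspace_uniform_topology[OF assms(2,3)])
  have nbhd: "neighbourhood_in T x N \<longleftrightarrow>
      N \<subseteq> topspace X \<and> (\<exists>C\<in>finite_covers (topspace X) \<B>. cover_star C x \<subseteq> N)"
    if "x \<in> topspace X" for x N
    unfolding T_def by (rule neighbourhood_in_uniform_topology_iff[OF assms(2,3) that])
  have nbhd_X: "neighbourhood_in X x N"
    if N: "neighbourhood_in T x N" and x: "x \<in> topspace X" for x N
  proof -
    obtain C where C: "N \<subseteq> topspace X" "C \<in> finite_covers (topspace X) \<B>" "cover_star C x \<subseteq> N"
      using N unfolding nbhd[OF x] by blast
    have "openin X (cover_star C x)"
      using assms(1) C(2) by (rule openin_cover_star)
    moreover have "x \<in> cover_star C x"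
      using C(2) x by (rule mem_cover_star)
    ultimately show ?thesis using C(1,3) unfolding neighbourhood_in_def by blast
  qed
  have coarse: "openin X W" if "openin T W" for W
  proof -
    have W: "W \<subseteq> topspace X" "\<And>x. x \<in> W \<Longrightarrow> neighbourhood_in T x W"
      using that unfolding openin_iff_neighbourhood_in[of T W] top by auto
    then show ?thesis unfolding openin_iff_neighbourhood_in[of X W] using nbhd_X by blast
  qed
  have "T = X \<longleftrightarrow> B_III X \<B>"
  proof
    assume "T = X"
    show "B_III X \<B>"
      unfolding B_III_def
    proof (intro ballI allI impI)
      fix x Y assume "x \<in> topspace X" "neighbourhood_in X x Y"
      then show "\<exists>C\<in>finite_covers (topspace X) \<B>. cover_star C x \<subseteq> Y"
        using nbhd[of x Y] \<open>T = X\<close> by simp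
    qed
  next
    assume III: "B_III X \<B>"
    have nbhd_T: "neighbourhood_in T x N" if "neighbourhood_in X x N" "x \<in> topspace X" for x N
    proof -
      have "N \<subseteq> topspace X" using that(1) by (simp add: neighbourhood_in_def)
      then show ?thesis using III that unfolding B_III_def nbhd[OF that(2)] by blast
    qed
    have "openin T W" if "openin X W" for W
    proof -
      have W: "W \<subseteq> topspace X" "\<And>x. x \<in> W \<Longrightarrow> neighbourhood_in X x W"
        using that unfolding openin_iff_neighbourhood_in[of X W] by auto
      then show ?thesis unfolding openin_iff_neighbourhood_in[of T W] top using nbhd_T by blast
    qed
    with coarse show "T = X" unfolding topology_eq by blast
  qed
  then show ?thesis
    using coarse top unfolding coarser_or_equal_def T_def by blast
qed

end
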